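(* Let $\tilde b=(\tilde b_{i,j})$ be a real array and assume that $(\tilde\rho,\tilde m)$ is the Nash equilibrium for the obstacle $\tilde b$, i.e. $$(\tilde\rho,\tilde m)=\operatorname*{argmin}_{(\rho,m)\in\mathcal C_{\mathcal G}(\mu_0)}\mathcal L_{\mathcal G}(\rho,m;\tilde b),$$ and that all entries of $\tilde\rho$ are strictly positive. Then any minimizer $b$ of the bilevel problem $$\min_{b}\ \tfrac12\|\rho-\tilde\rho\|^2+\tfrac12\|m^x-\tilde m^x\|^2+\tfrac12\|m^y-\tilde m^y\|^2\quad\text{s.t.}\quad(\rho,m)=\operatorname*{argmin}_{(\rho,m)\in\mathcal C_{\mathcal G}(\mu_0)}\mathcal L_{\mathcal G}(\rho,m;b)$$ has the form $b=\tilde b+c$ with a constant $c\in\mathbb R$ (the same constant added to every entry). Hence $\tilde b$ is the unique minimizer of this bilevel problem up to an additive constant.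
   Context: Discretization (space dimension $2$). Fix integers $n_x,n_y\ge 2$, $n_t\ge 1$ and set $\Delta x=1/n_x$, $\Delta y=1/n_y$, $\Delta t=1/n_t$. Indices: $1\le i\le n_x$, $1\le j\le n_y$, $1\le k\le n_t$ unless otherwise said. The unknowns are real arrays $\rho=(\rho_{i,j,k+1/2})$ and $m=(m^x,m^y)$ with $m^x=(m^x_{i+1/2,j,k})$ for $1\le i\le n_x-1$, and $m^y=(m^y_{i,j+1/2,k})$ for $1\le j\le n_y-1$. Data: an entrywise nonnegative array $\mu_0=((\mu_0)_{i,j})$, an entrywise positive array $\mu_1=((\mu_1)_{i,j})$, and weights $\gamma_I,\gamma_T\ge 0$. Conventions: $\rho_{i,j,1/2}:=(\mu_0)_{i,j}$, $m^x_{1/2,j,k}=m^x_{n_x+1/2,j,k}:=0$, $m^y_{i,1/2,k}=m^y_{i,n_y+1/2,k}:=0$. Interpolations: $\bar\rho_{i,j,k}=\frac12(\rho_{i,j,k-1/2}+\rho_{i,j,k+1/2})$, $\overline{m^x}_{i,j,k}=\frac12(m^x_{i-1/2,j,k}+m^x_{i+1/2,j,k})$, $\overline{m^y}_{i,j,k}=\frac12(m^y_{i,j-1/2,k}+m^y_{i,j+1/2,k})$, $\bar m=(\overline{m^x},\overline{m^y})^\top$. Constraint set: $\mathcal C_{\mathcal G}(\mu_0)$ is the set of $(\rho,m)$ such that for all $i,j,k$ $$\tfrac1{\Delta t}(\rho_{i,j,k+1/2}-\rho_{i,j,k-1/2})+\tfrac1{\Delta x}(m^x_{i+1/2,j,k}-m^x_{i-1/2,j,k})+\tfrac1{\Delta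 y}(m^y_{i,j+1/2,k}-m^y_{i,j-1/2,k})=0.$$ Objective, for a real array (obstacle) $b=(b_{i,j})$, defined for $\rho$ with all entries positive: $$\mathcal L_{\mathcal G}(\rho,m;b)=\Delta x\Delta y\Delta t\sum_{i,j,k}\Bigl(\frac{|\bar m_{i,j,k}|^2}{2\bar\rho_{i,j,k}}+\gamma_I\bar\rho_{i,j,k}\log\bar\rho_{i,j,k}\Bigr)+\Delta x\Delta y\Delta t\sum_{i,j,k}\rho_{i,j,k+1/2}\,b_{i,j}+\gamma_T\Delta x\Delta y\sum_{i,j}\rho_{i,j,n_t+1/2}\bigl(\log\rho_{i,j,n_t+1/2}-\log(\mu_1)_{i,j}\bigr).$$ Minimization over $\mathcal C_{\mathcal G}(\mu_0)$ is over pairs with $\rho$ entrywise positive. The norms in the upper-level objective are $\|f\|^2=\Delta x\Delta y\Delta t\sum f_{\mathbf i}^2$, the sum being over all entries of the array $f$. The minimization of the bilevel problem is over all real arrays $b=(b_{i,j})$, subject to $(\rho,m)$ being a minimizer of the lower-level problem for $b$. *)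

theory Defs
  imports Complex_Main
begin

text \<open>
  Arrays are functions on natural-number indices. A half-integer index is rounded down:
  \<open>r i j k\<close>, \<open>mx i j k\<close>, \<open>my i j k\<close> stand for \<open>\<rho>\<close> at \<open>(i, j, k + 1/2)\<close>, \<open>m\<^sup>x\<close> at
  \<open>(i + 1/2, j, k)\<close> and \<open>m\<^sup>y\<close> at \<open>(i, j + 1/2, k)\<close>. Only the values at the indices in \<open>rho_ix\<close>,
  \<open>mx_ix\<close> and \<open>my_ix\<close> (and \<open>1 \<le> i \<le> nx\<close>, \<open>1 \<le> j \<le> ny\<close> for arrays in the space variables
  only) are entries of the array; no definition below depends on any other value.
\<close>

type_synonym array2 = "nat \<Rightarrow> nat \<Rightarrow> real"
type_synonym array3 = "nat \<Rightarrow> nat \<Rightarrow> nat \<Rightarrow> real"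

definition rho_ix :: "nat \<Rightarrow> nat \<Rightarrow> nat \<Rightarrow> (nat \<times> nat \<times> nat) set" where
  "rho_ix nx ny nt = {1..nx} \<times> {1..ny} \<times> {1..nt}"

definition mx_ix :: "nat \<Rightarrow> nat \<Rightarrow> nat \<Rightarrow> (nat \<times> nat \<times> nat) set" where
  "mx_ix nx ny nt = {1..nx - 1} \<times> {1..ny} \<times> {1..nt}"

definition my_ix :: "nat \<Rightarrow> nat \<Rightarrow> nat \<Rightarrow> (nat \<times> nat \<times> nat) set" where
  "my_ix nx ny nt = {1..nx} \<times> {1..ny - 1} \<times> {1..nt}"

definition step :: "nat \<Rightarrow> real" where
  "step n = 1 / real n"

text \<open>Extension by the initial datum at time index \<open>1/2\<close> and by zero boundary flux.\<close>

definition rho_ext :: "array2 \<Rightarrow> array3 \<Rightarrow> array3" where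
  "rho_ext mu0 r i j k = (if k = 0 then mu0 i j else r i j k)"

definition mx_ext :: "nat \<Rightarrow> array3 \<Rightarrow> array3" where
  "mx_ext nx mx i j k = (if i = 0 \<or> i = nx then 0 else mx i j k)"

definition my_ext :: "nat \<Rightarrow> array3 \<Rightarrow> array3" where
  "my_ext ny my i j k = (if j = 0 \<or> j = ny then 0 else my i j k)"

text \<open>The interpolations are used at integer indices \<open>i, j, k \<ge> 1\<close>, so the subtractions are exact.\<close>

definition rho_bar :: "array2 \<Rightarrow> array3 \<Rightarrow> array3" where
  "rho_bar mu0 r i j k = (rho_ext mu0 r i j (k - 1) + rho_ext mu0 r i j k) / 2"

definition mx_bar :: "nat \<Rightarrow> array3 \<Rightarrow> array3" where
  "mx_bar nx mx i j k = (mx_ext nx mx (i - 1) j k + mx_ext nx mx i j k) / 2"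

definition my_bar :: "nat \<Rightarrow> array3 \<Rightarrow> array3" where
  "my_bar ny my i j k = (my_ext ny my i (j - 1) k + my_ext ny my i j k) / 2"

definition constraint_set ::
  "nat \<Rightarrow> nat \<Rightarrow> nat \<Rightarrow> array2 \<Rightarrow> (array3 \<times> array3 \<times> array3) set" where
  "constraint_set nx ny nt mu0 = {(r, mx, my).
     \<forall>(i, j, k) \<in> rho_ix nx ny nt.
         (rho_ext mu0 r i j k - rho_ext mu0 r i j (k - 1)) / step nt
       + (mx_ext nx mx i j k - mx_ext nx mx (i - 1) j k) / step nx
       + (my_ext ny my i j k - my_ext ny my i (j - 1) k) / step ny = 0}"

definition rho_positive :: "nat \<Rightarrow> nat \<Rightarrow> nat \<Rightarrow> array3 \<Rightarrow> bool" where
  "rho_positive nx ny nt r \<longleftrightarrow> (\<forall>(i, j, k) \<in> rho_ix nx ny nt. 0 < r i j k)"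

text \<open>The objective is only meaningful when \<^term>\<open>rho_positive nx ny nt r\<close> holds
  and \<open>mu0\<close> is nonnegative: then all entries of \<open>rho_bar mu0 r\<close> are positive.\<close>

definition objective ::
  "nat \<Rightarrow> nat \<Rightarrow> nat \<Rightarrow> real \<Rightarrow> real \<Rightarrow> array2 \<Rightarrow> array2 \<Rightarrow> array2 \<Rightarrow>
   array3 \<times> array3 \<times> array3 \<Rightarrow> real" where
  "objective nx ny nt gI gT mu0 mu1 b = (\<lambda>(r, mx, my).
       step nx * step ny * step nt *
         (\<Sum>(i, j, k) \<in> rho_ix nx ny nt.
            ((mx_bar nx mx i j k)\<^sup>2 + (my_bar ny my i j k)\<^sup>2) / (2 * rho_bar mu0 r i j k)
            + gI * rho_bar mu0 r i j k * ln (rho_bar mu0 r i j k))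
     + step nx * step ny * step nt * (\<Sum>(i, j, k) \<in> rho_ix nx ny nt. r i j k * b i j)
     + gT * step nx * step ny *
         (\<Sum>(i, j) \<in> {1..nx} \<times> {1..ny}. r i j nt * (ln (r i j nt) - ln (mu1 i j))))"

definition nash_equilibrium ::
  "nat \<Rightarrow> nat \<Rightarrow> nat \<Rightarrow> real \<Rightarrow> real \<Rightarrow> array2 \<Rightarrow> array2 \<Rightarrow> array2 \<Rightarrow>
   array3 \<times> array3 \<times> array3 \<Rightarrow> bool" where
  "nash_equilibrium nx ny nt gI gT mu0 mu1 b =
     is_arg_min (objective nx ny nt gI gT mu0 mu1 b)
       (\<lambda>(r, mx, my). (r, mx, my) \<in> constraint_set nx ny nt mu0 \<and> rho_positive nx ny nt r)"

definition norm_sq ::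
  "nat \<Rightarrow> nat \<Rightarrow> nat \<Rightarrow> (nat \<times> nat \<times> nat) set \<Rightarrow> array3 \<Rightarrow> real" where
  "norm_sq nx ny nt I f = step nx * step ny * step nt * (\<Sum>(i, j, k) \<in> I. (f i j k)\<^sup>2)"

definition misfit ::
  "nat \<Rightarrow> nat \<Rightarrow> nat \<Rightarrow> array3 \<times> array3 \<times> array3 \<Rightarrow> array3 \<times> array3 \<times> array3 \<Rightarrow> real" where
  "misfit nx ny nt = (\<lambda>(r', mx', my') (r, mx, my).
       norm_sq nx ny nt (rho_ix nx ny nt) (\<lambda>i j k. r i j k - r' i j k) / 2
     + norm_sq nx ny nt (mx_ix nx ny nt) (\<lambda>i j k. mx i j k - mx' i j k) / 2
     + norm_sq nx ny nt (my_ix nx ny nt) (\<lambda>i j k. my i j k - my' i j k) / 2)"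

text \<open>
  Uniqueness of lower-level minimizers is not presupposed: the bilevel problem is posed over
  pairs of an obstacle and one of its lower-level minimizers.
\<close>

definition bilevel_minimizer ::
  "nat \<Rightarrow> nat \<Rightarrow> nat \<Rightarrow> real \<Rightarrow> real \<Rightarrow> array2 \<Rightarrow> array2 \<Rightarrow>
   array3 \<times> array3 \<times> array3 \<Rightarrow> array2 \<Rightarrow> bool" where
  "bilevel_minimizer nx ny nt gI gT mu0 mu1 target b \<longleftrightarrow>
     (\<exists>s. is_arg_min (\<lambda>(b', s'). misfit nx ny nt target s')
            (\<lambda>(b', s'). nash_equilibrium nx ny nt gI gT mu0 mu1 b' s') (b, s))"

end

theory Submission
  imports Defs
begin

text \<open>
  If one state is optimal for two obstacles, then the directional derivatives of both objectives
  vanish in every direction tangent to the constraint set. The objectives differ by a term that is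
  linear in \<open>\<rho>\<close>, so the difference of the obstacles annihilates every tangent \<open>\<rho>\<close>-direction.
  Moving mass between two neighbouring cells in the last time step is such a direction; hence the
  difference takes the same value on neighbouring cells and is constant. Conversely,
  the continuity equation conserves mass, so adding a constant to the obstacle adds a constant to
  the objective. Attainability of the target makes the optimal value of the misfit zero.
\<close>

section \<open>Positivity and perturbations along straight lines\<close>

lemma step_pos: "n > 0 \<Longrightarrow> 0 < step n"
  by (simp add: step_def)

lemma finite_ix:
  "finite (rho_ix nx ny nt)" "finite (mx_ix nx ny nt)" "finite (my_ix nx ny nt)"
  by (simp_all add: rho_ix_def mx_ix_def my_ix_def)

text \<open>Every average contains at least one unknown density entry, which is positive; the other
  term is either such an entry or a value of \<open>mu0\<close>, so \<open>mu0\<close> may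
  vanish.\<close>

lemma rho_bar_pos:
  assumes "rho_positive nx ny nt r" and "\<forall>i\<in>{1..nx}. \<forall>j\<in>{1..ny}. mu0 i j \<ge> 0"
    and "(i, j, k) \<in> rho_ix nx ny nt"
  shows "rho_bar mu0 r i j k > 0"
proof -
  have "r i j k > 0" "mu0 i j \<ge> 0" "k \<ge> 1"
    using assms by (auto simp: rho_positive_def rho_ix_def)
  moreover have "r i j (k - 1) > 0" if "k - 1 \<noteq> 0"
  proof -
    have "(i, j, k - 1) \<in> rho_ix nx ny nt"
      using assms(3) that by (auto simp: rho_ix_def)
    then show ?thesis using assms(1) by (auto simp: rho_positive_def)
  qed
  ultimately show ?thesis
    by (auto simp: rho_bar_def rho_ext_def add_nonneg_pos add_pos_pos)
qed

text \<open>A perturbation must not move the initial datum, so its direction \<open>d\<close> is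
  extended by zero at time index 0. This is why tangent directions below are the elements of
  \<open>constraint_set\<close> with zero datum.\<close>

lemma rho_ext_line:
  "rho_ext mu0 (\<lambda>i j k. r i j k + t * d i j k) i j k
     = rho_ext mu0 r i j k + t * rho_ext (\<lambda>_ _. 0) d i j k"
  by (simp add: rho_ext_def)

lemma mx_ext_line:
  "mx_ext nx (\<lambda>i j k. m i j k + t * d i j k) i j k = mx_ext nx m i j k + t * mx_ext nx d i j k"
  by (simp add: mx_ext_def)

lemma my_ext_line:
  "my_ext ny (\<lambda>i j k. m i j k + t * d i j k) i j k = my_ext ny m i j k + t * my_ext ny d i j k"
  by (simp add: my_ext_def)

lemma rho_bar_line:
  "rho_bar mu0 (\<lambda>i j k. r i j k + t * d i j k) i j k
     = rho_bar mu0 r i j k + t * rho_bar (\<lambda>_ _. 0) d i j k"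
  unfolding rho_bar_def rho_ext_line by (simp add: field_simps)

lemma mx_bar_line:
  "mx_bar nx (\<lambda>i j k. m i j k + t * d i j k) i j k = mx_bar nx m i j k + t * mx_bar nx d i j k"
  unfolding mx_bar_def mx_ext_line by (simp add: field_simps)

lemma my_bar_line:
  "my_bar ny (\<lambda>i j k. m i j k + t * d i j k) i j k = my_bar ny m i j k + t * my_bar ny d i j k"
  unfolding my_bar_def my_ext_line by (simp add: field_simps)

lemma constraint_set_line:
  assumes "(r, mx, my) \<in> constraint_set nx ny nt mu0"
    and "(d, e, f) \<in> constraint_set nx ny nt (\<lambda>_ _. 0)"
  shows "(\<lambda>i j k. r i j k + t * d i j k, \<lambda>i j k. mx i j k + t * e i j k,
          \<lambda>i j k. my i j k + t * f i j k) \<in> constraint_set nx ny nt mu0"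
proof -
  \<comment> \<open>Stated for free real variables, so that it serves as a rewrite rule splitting
    the perturbed equation into the original one plus \<open>t\<close> times the homogeneous
    one.\<close>
  have line: "(a + t * a' - (b + t * b')) / s + (c + t * c' - (g + t * g')) / s'
          + (h + t * h' - (l + t * l')) / s''
        = ((a - b) / s + (c - g) / s' + (h - l) / s'')
          + t * ((a' - b') / s + (c' - g') / s' + (h' - l') / s'')"
    for a a' b b' s c c' g g' s' h h' l l' s'' :: real
    by (simp add: diff_divide_distrib add_divide_distrib algebra_simps)
  show ?thesis
    unfolding constraint_set_def mem_Collect_eq prod.case rho_ext_line mx_ext_line my_ext_line line
    using assms by (auto simp: constraint_set_def split_beta)
qed

text \<open>Finitely many strict inequalities survive a small change. Since \<open>t\<close> may
  have either sign, a minimizer gives a vanishing derivative and not just an inequality.\<close>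

lemma eventually_rho_positive_line:
  assumes "rho_positive nx ny nt r"
  shows "\<forall>\<^sub>F t in nhds (0::real). rho_positive nx ny nt (\<lambda>i j k. r i j k + t * d i j k)"
proof -
  have "\<forall>\<^sub>F t in nhds (0::real). 0 < r i j k + t * d i j k"
    if "(i, j, k) \<in> rho_ix nx ny nt" for i j k
  proof -
    have "((\<lambda>t::real. r i j k + t * d i j k) \<longlongrightarrow> r i j k + 0 * d i j k) (nhds 0)"
      by (intro tendsto_intros filterlim_ident)
    moreover have "0 < r i j k + 0 * d i j k"
      using assms that by (auto simp: rho_positive_def)
    ultimately show ?thesis by (rule order_tendstoD(1))
  qed
  then have "\<forall>\<^sub>F t in nhds (0::real). \<forall>p\<in>rho_ix nx ny nt.
      case p of (i, j, k) \<Rightarrow> 0 < r i j k + t * d i j k"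
    by (intro eventually_ball_finite finite_ix) auto
  then show ?thesis by (simp add: rho_positive_def)
qed

section \<open>Differentiability of the objective along a line\<close>

lemma interior_cost_differentiable:
  fixes a a' b b' p q g :: real
  assumes "p > 0"
  shows "(\<lambda>t. ((a + t * a')\<^sup>2 + (b + t * b')\<^sup>2) / (2 * (p + t * q))
            + g * (p + t * q) * ln (p + t * q)) differentiable (at 0)"
  unfolding real_differentiable_def using assms by (auto intro!: exI derivative_eq_intros)

lemma terminal_cost_differentiable:
  fixes p q l :: real
  assumes "p > 0"
  shows "(\<lambda>t. (p + t * q) * (ln (p + t * q) - l)) differentiable (at 0)"
  unfolding real_differentiable_def using assms by (auto intro!: exI derivative_eq_intros)

text \<open>Only the existence of the derivative matters: its value cancels when two obstacles are
  compared, so no formula is computed.\<close>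

lemma objective_line_differentiable:
  assumes "rho_positive nx ny nt r" and "\<forall>i\<in>{1..nx}. \<forall>j\<in>{1..ny}. mu0 i j \<ge> 0" and "nt \<ge> 1"
  shows "(\<lambda>t. objective nx ny nt gI gT mu0 mu1 b
           (\<lambda>i j k. r i j k + t * d i j k, \<lambda>i j k. mx i j k + t * e i j k,
            \<lambda>i j k. my i j k + t * f i j k)) differentiable (at (0::real))"
proof -
  have rpos: "r i j nt > 0" if "i \<in> {1..nx}" "j \<in> {1..ny}" for i j
    using assms(1,3) that by (auto simp: rho_positive_def rho_ix_def)
  show ?thesis
    unfolding objective_def prod.case rho_bar_line mx_bar_line my_bar_line
    unfolding case_prod_unfold
    \<comment> \<open>The two cost lemmas come first so that each summand is matched as a whole; the
      remaining rules cover sums and products but neither quotients nor logarithms.\<close>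
    by (rule interior_cost_differentiable terminal_cost_differentiable rho_bar_pos[OF assms(1,2)]
          rpos ballI finite_ix finite_cartesian_product finite_atLeastAtMost differentiable_sum
          differentiable_const differentiable_ident differentiable_add differentiable_mult
        | (simp add: mem_Times_iff; fail))+
qed

section \<open>First-order comparison of two obstacles at a common minimizer\<close>

lemma objective_change_obstacle:
  "objective nx ny nt gI gT mu0 mu1 b (r, mx, my)
     = objective nx ny nt gI gT mu0 mu1 b' (r, mx, my)
       + step nx * step ny * step nt * (\<Sum>(i, j, k) \<in> rho_ix nx ny nt. r i j k * (b i j - b' i j))"
  by (simp add: objective_def right_diff_distrib case_prod_unfold sum_subtractf)

text \<open>The derivative at a local minimum vanishes; applied to \<open>F\<close> and to
  \<open>F t + t * C\<close> this gives \<open>D = 0\<close> and \<open>D + C = 0\<close>.\<close>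

lemma slope_zero_of_common_minimum:
  fixes F :: "real \<Rightarrow> real"
  assumes "(F has_real_derivative D) (at 0)"
    and "\<forall>\<^sub>F t in nhds 0. F 0 \<le> F t"
    and "\<forall>\<^sub>F t in nhds 0. F 0 \<le> F t + t * C"
  shows "C = 0"
proof -
  have min: "E = 0" if G: "(G has_real_derivative E) (at 0)" "\<forall>\<^sub>F t in nhds 0. G 0 \<le> G t"
    for G :: "real \<Rightarrow> real" and E
  proof -
    obtain e where "e > 0" "\<And>y. \<bar>0 - y\<bar> < e \<Longrightarrow> G 0 \<le> G y"
      using G(2) by (auto simp: eventually_nhds_metric dist_real_def)
    then show ?thesis using DERIV_local_min[OF G(1)] by blast
  qed
  have "((\<lambda>t. F t + t * C) has_real_derivative D + C) (at 0)"
    using assms(1) by (auto intro!: derivative_eq_intros)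
  from min[OF this] min[OF assms(1,2)] assms(3) show ?thesis by simp
qed

lemma obstacle_difference_orthogonal:
  assumes N: "nash_equilibrium nx ny nt gI gT mu0 mu1 bt (r, mx, my)"
    and N': "nash_equilibrium nx ny nt gI gT mu0 mu1 b (r, mx, my)"
    and mu0: "\<forall>i\<in>{1..nx}. \<forall>j\<in>{1..ny}. mu0 i j \<ge> 0"
    and pos: "nx > 0" "ny > 0" "nt > 0"
    and tangent: "(d, e, f) \<in> constraint_set nx ny nt (\<lambda>_ _. 0)"
  shows "(\<Sum>(i, j, k) \<in> rho_ix nx ny nt. d i j k * (b i j - bt i j)) = 0" (is "?S = 0")
proof -
  define L where "L t = (\<lambda>i j k. r i j k + t * d i j k, \<lambda>i j k. mx i j k + t * e i j k,
    \<lambda>i j k. my i j k + t * f i j k)" for t :: real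
  define F where "F t = objective nx ny nt gI gT mu0 mu1 bt (L t)" for t
  let ?h = "step nx * step ny * step nt"
  have r: "rho_positive nx ny nt r" and c: "(r, mx, my) \<in> constraint_set nx ny nt mu0"
    using N by (auto simp: nash_equilibrium_def is_arg_min_def)
  have L0: "L 0 = (r, mx, my)" by (simp add: L_def)
  have min: "\<forall>\<^sub>F t in nhds 0. objective nx ny nt gI gT mu0 mu1 b' (L 0)
      \<le> objective nx ny nt gI gT mu0 mu1 b' (L t)"
    if "nash_equilibrium nx ny nt gI gT mu0 mu1 b' (r, mx, my)" for b'
    \<comment> \<open>The constraint holds on the whole line and positivity holds near 0, so
      \<open>L t\<close> is an admissible competitor for all small \<open>t\<close>.\<close>
    using eventually_rho_positive_line[OF r, of d]
  proof eventually_elim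
    case (elim t)
    then show ?case
      using that constraint_set_line[OF c tangent, of t] unfolding L0
      by (auto simp: L_def nash_equilibrium_def is_arg_min_def not_less)
  qed
  \<comment> \<open>The two objectives differ along the line by an affine function of
    \<open>t\<close>. Its constant part cancels when the values at \<open>t\<close> and at 0 are
    compared; its slope is the cell volume times the sum in question.\<close>
  have Fb: "objective nx ny nt gI gT mu0 mu1 b (L t)
      = F t + ?h * (\<Sum>(i, j, k) \<in> rho_ix nx ny nt. r i j k * (b i j - bt i j)) + t * (?h * ?S)" for t
    unfolding F_def L_def objective_change_obstacle[where b = b and b' = bt]
    by (simp add: case_prod_unfold distrib_right sum.distrib distrib_left sum_distrib_left mult_ac)
  obtain D where "(F has_real_derivative D) (at 0)"
    using objective_line_differentiable[OF r mu0] pos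
    unfolding F_def L_def real_differentiable_def by fastforce
  moreover have "\<forall>\<^sub>F t in nhds 0. F 0 \<le> F t"
    using min[OF N] by (simp add: F_def)
  moreover have "\<forall>\<^sub>F t in nhds 0. F 0 \<le> F t + t * (?h * ?S)"
    using min[OF N'] by (simp add: Fb)
  ultimately have "?h * ?S = 0" by (rule slope_zero_of_common_minimum)
  then show ?thesis using pos by (auto simp: step_def)
qed

section \<open>Moving mass between neighbouring cells\<close>

text \<open>A unit flux through one interior face in the last time layer is balanced by density
  changes in the two adjacent cells; the continuity equation fixes their size as
  \<open>step nt / step nx\<close>. In the last layer no later equation sees the change, so nothing
  has to be compensated afterwards.\<close>

lemma transfer_x_tangent:
  assumes "i \<ge> 1" "i < nx"
  shows "(\<lambda>i' j' k'. step nt / step nx *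
            (of_bool ((i', j', k') = (i + 1, j, nt)) - of_bool ((i', j', k') = (i, j, nt))),
          \<lambda>i' j' k'. of_bool ((i', j', k') = (i, j, nt)), \<lambda>_ _ _. 0)
         \<in> constraint_set nx ny nt (\<lambda>_ _. 0)"
    (is "(?d, ?e, _) \<in> _")
proof -
  have "(rho_ext (\<lambda>_ _. 0) ?d i' j' k' - rho_ext (\<lambda>_ _. 0) ?d i' j' (k' - 1)) / step nt
      + (mx_ext nx ?e i' j' k' - mx_ext nx ?e (i' - 1) j' k') / step nx
      + (my_ext ny (\<lambda>_ _ _. 0) i' j' k' - my_ext ny (\<lambda>_ _ _. 0) i' (j' - 1) k') / step ny = 0"
    if ix: "(i', j', k') \<in> rho_ix nx ny nt" for i' j' k'
  proof -
    have k: "1 \<le> k'" "k' \<le> nt" and i: "1 \<le> i'" using ix by (auto simp: rho_ix_def)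
    have pos: "step nt > 0" "step nx > 0" using k assms by (simp_all add: step_pos)
    have "rho_ext (\<lambda>_ _. 0) ?d i' j' k' = ?d i' j' k'" using k by (simp add: rho_ext_def)
    \<comment> \<open>For \<open>k' = 1\<close> this is the zero initial datum; otherwise
      \<open>k' - 1\<close> lies strictly before the layer \<open>nt\<close> that carries
      \<open>d\<close>.\<close>
    moreover have "rho_ext (\<lambda>_ _. 0) ?d i' j' (k' - 1) = 0"
      using k by (auto simp: rho_ext_def)
    \<comment> \<open>The bounds on \<open>i\<close> keep the flux off the boundary faces, where
      \<open>mx_ext\<close> would erase it.\<close>
    moreover have "mx_ext nx ?e i' j' k' = of_bool ((i', j', k') = (i, j, nt))"
      using assms by (auto simp: mx_ext_def)
    moreover have "mx_ext nx ?e (i' - 1) j' k' = of_bool ((i', j', k') = (i + 1, j, nt))"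
      using assms i by (auto simp: mx_ext_def)
    ultimately show ?thesis
      using pos by (simp only: my_ext_def if_cancel) (simp add: field_simps del: of_bool_eq_iff)
  qed
  then show ?thesis by (auto simp: constraint_set_def)
qed

lemma transfer_y_tangent:
  assumes "j \<ge> 1" "j < ny"
  shows "(\<lambda>i' j' k'. step nt / step ny *
            (of_bool ((i', j', k') = (i, j + 1, nt)) - of_bool ((i', j', k') = (i, j, nt))),
          \<lambda>_ _ _. 0, \<lambda>i' j' k'. of_bool ((i', j', k') = (i, j, nt)))
         \<in> constraint_set nx ny nt (\<lambda>_ _. 0)"
    (is "(?d, _, ?e) \<in> _")
proof -
  have "(rho_ext (\<lambda>_ _. 0) ?d i' j' k' - rho_ext (\<lambda>_ _. 0) ?d i' j' (k' - 1)) / step nt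
      + (mx_ext nx (\<lambda>_ _ _. 0) i' j' k' - mx_ext nx (\<lambda>_ _ _. 0) (i' - 1) j' k') / step nx
      + (my_ext ny ?e i' j' k' - my_ext ny ?e i' (j' - 1) k') / step ny = 0"
    if ix: "(i', j', k') \<in> rho_ix nx ny nt" for i' j' k'
  proof -
    have k: "1 \<le> k'" "k' \<le> nt" and j: "1 \<le> j'" using ix by (auto simp: rho_ix_def)
    have pos: "step nt > 0" "step ny > 0" using k assms by (simp_all add: step_pos)
    have "rho_ext (\<lambda>_ _. 0) ?d i' j' k' = ?d i' j' k'" using k by (simp add: rho_ext_def)
    moreover have "rho_ext (\<lambda>_ _. 0) ?d i' j' (k' - 1) = 0"
      using k by (auto simp: rho_ext_def)
    moreover have "my_ext ny ?e i' j' k' = of_bool ((i', j', k') = (i, j, nt))"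
      using assms by (auto simp: my_ext_def)
    moreover have "my_ext ny ?e i' (j' - 1) k' = of_bool ((i', j', k') = (i, j + 1, nt))"
      using assms j by (auto simp: my_ext_def)
    ultimately show ?thesis
      using pos by (simp only: mx_ext_def if_cancel) (simp add: field_simps del: of_bool_eq_iff)
  qed
  then show ?thesis by (auto simp: constraint_set_def)
qed

text \<open>Evaluates the orthogonality relation on a transfer direction. \<open>D\<close> carries
  no time index because obstacles depend on space only.\<close>

lemma sum_transfer:
  fixes h :: real
  assumes "finite A" "(p1, p2, p3) \<in> A" "(q1, q2, q3) \<in> A"
  shows "(\<Sum>(i, j, k)\<in>A. h * (of_bool ((i, j, k) = (p1, p2, p3)) - of_bool ((i, j, k) = (q1, q2, q3)))
            * D i j) = h * (D p1 p2 - D q1 q2)"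
proof -
  have cell: "(\<Sum>z\<in>A. of_bool (z = p) * g z) = g p" if "p \<in> A" for p and g :: "_ \<Rightarrow> real"
    using assms(1) that by (simp add: of_bool_def if_distrib[of "\<lambda>x. x * _"] cong: if_cong)
  have "(\<Sum>(i, j, k)\<in>A. h * (of_bool ((i, j, k) = (p1, p2, p3)) - of_bool ((i, j, k) = (q1, q2, q3)))
            * D i j)
      = (\<Sum>z\<in>A. of_bool (z = (p1, p2, p3)) * (h * D (fst z) (fst (snd z))))
        - (\<Sum>z\<in>A. of_bool (z = (q1, q2, q3)) * (h * D (fst z) (fst (snd z))))"
    unfolding sum_subtractf[symmetric]
    by (intro sum.cong refl) (simp only: case_prod_unfold prod.collapse algebra_simps)
  then show ?thesis
    using assms(2,3) by (simp only: cell fst_conv snd_conv right_diff_distrib)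
qed

text \<open>Each transfer equates the obstacle difference on two adjacent cells. Any cell is joined
  to \<open>(1, 1)\<close> by a path first in \<open>x\<close>, then in \<open>y\<close>, so the
  constant is the difference at \<open>(1, 1)\<close>.\<close>

lemma obstacle_difference_constant:
  assumes N: "nash_equilibrium nx ny nt gI gT mu0 mu1 bt (r, mx, my)"
    and N': "nash_equilibrium nx ny nt gI gT mu0 mu1 b (r, mx, my)"
    and mu0: "\<forall>i\<in>{1..nx}. \<forall>j\<in>{1..ny}. mu0 i j \<ge> 0"
    and pos: "nx > 0" "ny > 0" "nt > 0"
  shows "\<exists>c. \<forall>i\<in>{1..nx}. \<forall>j\<in>{1..ny}. b i j = bt i j + c"
proof -
  let ?D = "\<lambda>i j. b i j - bt i j"
  note orth = obstacle_difference_orthogonal[OF N N' mu0 pos]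
  have x: "?D (i + 1) j = ?D i j" if "i \<ge> 1" "i < nx" "j \<in> {1..ny}" for i j
  proof -
    have "(i + 1, j, nt) \<in> rho_ix nx ny nt" "(i, j, nt) \<in> rho_ix nx ny nt"
      using that pos by (auto simp: rho_ix_def)
    then have "step nt / step nx * (?D (i + 1) j - ?D i j) = 0"
      using orth[OF transfer_x_tangent[OF that(1,2)], of j]
      by (simp only: sum_transfer finite_ix)
    then show ?thesis using pos by (simp add: step_def)
  qed
  have y: "?D i (j + 1) = ?D i j" if "j \<ge> 1" "j < ny" "i \<in> {1..nx}" for i j
  proof -
    have "(i, j + 1, nt) \<in> rho_ix nx ny nt" "(i, j, nt) \<in> rho_ix nx ny nt"
      using that pos by (auto simp: rho_ix_def)
    then have "step nt / step ny * (?D i (j + 1) - ?D i j) = 0"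
      using orth[OF transfer_y_tangent[OF that(1,2)], of i]
      by (simp only: sum_transfer finite_ix)
    then show ?thesis using pos by (simp add: step_def)
  qed
  \<comment> \<open>The upper bound stays inside the induction claim: at \<open>Suc i\<close> it
    yields the strict bound that \<open>x\<close> requires.\<close>
  have x1: "i \<le> nx \<longrightarrow> (\<forall>j\<in>{1..ny}. ?D i j = ?D 1 j)" if "i \<ge> 1" for i
    using that by (induction i rule: dec_induct) (use x in force)+
  have y1: "j \<le> ny \<longrightarrow> ?D 1 j = ?D 1 1" if "j \<ge> 1" for j
    using that by (induction j rule: dec_induct) (use y[of _ 1] pos in force)+
  have "b i j = bt i j + ?D 1 1" if "i \<in> {1..nx}" "j \<in> {1..ny}" for i j
    using x1[of i] y1[of j] that by force
  then show ?thesis by blast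
qed

lemma sum_rho_ix:
  "(\<Sum>(i, j, k) \<in> rho_ix nx ny nt. g i j k) = (\<Sum>i=1..nx. \<Sum>j=1..ny. \<Sum>k=1..nt. g i j k)"
  by (simp add: rho_ix_def sum.cartesian_product)

section \<open>What a vanishing misfit determines\<close>

text \<open>Arrays are total functions, and zero misfit only equates their genuine entries. Such
  states need not be equal as functions, but they have the same objective value. The bound on
  \<open>nt\<close> makes the terminal value \<open>r i j nt\<close> a genuine entry.\<close>

lemma objective_cong:
  assumes "\<forall>(i, j, k)\<in>rho_ix nx ny nt. r i j k = r' i j k"
    and "\<forall>(i, j, k)\<in>mx_ix nx ny nt. mx i j k = mx' i j k"
    and "\<forall>(i, j, k)\<in>my_ix nx ny nt. my i j k = my' i j k"
    and "nt \<ge> 1"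
  shows "objective nx ny nt gI gT mu0 mu1 b (r, mx, my)
    = objective nx ny nt gI gT mu0 mu1 b (r', mx', my')"
proof -
  have r: "rho_ext mu0 r i j k = rho_ext mu0 r' i j k"
    if "i \<in> {1..nx}" "j \<in> {1..ny}" "k \<le> nt" for i j k
    using assms(1) that by (cases "k = 0") (auto simp: rho_ext_def rho_ix_def)
  have mx: "mx_ext nx mx i j k = mx_ext nx mx' i j k"
    if "i \<le> nx" "j \<in> {1..ny}" "k \<in> {1..nt}" for i j k
  \<comment> \<open>An averaged flux also reads the boundary indices 0 and \<open>nx\<close>; there
    both extensions are zero whatever the arrays contain.\<close>
  proof (cases "i = 0 \<or> i = nx")
    case False
    then have "(i, j, k) \<in> mx_ix nx ny nt" using that by (auto simp: mx_ix_def)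
    then show ?thesis using assms(2) by (auto simp: mx_ext_def)
  qed (auto simp: mx_ext_def)
  have my: "my_ext ny my i j k = my_ext ny my' i j k"
    if "i \<in> {1..nx}" "j \<le> ny" "k \<in> {1..nt}" for i j k
  proof (cases "j = 0 \<or> j = ny")
    case False
    then have "(i, j, k) \<in> my_ix nx ny nt" using that by (auto simp: my_ix_def)
    then show ?thesis using assms(3) by (auto simp: my_ext_def)
  qed (auto simp: my_ext_def)
  have "rho_bar mu0 r i j k = rho_bar mu0 r' i j k" "mx_bar nx mx i j k = mx_bar nx mx' i j k"
    "my_bar ny my i j k = my_bar ny my' i j k" "r i j k = r' i j k"
    if "(i, j, k) \<in> rho_ix nx ny nt" for i j k
  proof -
    have ix: "i \<in> {1..nx}" "j \<in> {1..ny}" "k \<in> {1..nt}" using that by (auto simp: rho_ix_def)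
    then have "i - 1 \<le> nx" "i \<le> nx" "j - 1 \<le> ny" "j \<le> ny" "k - 1 \<le> nt" "k \<le> nt" by auto
    with ix show "rho_bar mu0 r i j k = rho_bar mu0 r' i j k"
      "mx_bar nx mx i j k = mx_bar nx mx' i j k" "my_bar ny my i j k = my_bar ny my' i j k"
      by (simp_all only: rho_bar_def mx_bar_def my_bar_def r mx my)
    show "r i j k = r' i j k" using that assms(1) by auto
  qed
  moreover have "r i j nt = r' i j nt" if "(i, j) \<in> {1..nx} \<times> {1..ny}" for i j
    using that assms(1,4) by (auto simp: rho_ix_def)
  ultimately show ?thesis
    unfolding objective_def prod.case
    by (intro arg_cong2[where f = "(+)"] arg_cong2[where f = "(*)"] sum.cong refl) auto
qed

lemma norm_sq_nonneg: "norm_sq nx ny nt I f \<ge> 0"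
  unfolding norm_sq_def step_def case_prod_unfold by (intro mult_nonneg_nonneg sum_nonneg) simp_all

lemma misfit_nonneg: "misfit nx ny nt s s' \<ge> 0"
  unfolding misfit_def case_prod_unfold by (simp add: norm_sq_nonneg)

lemma misfit_self: "misfit nx ny nt s s = 0"
  by (simp add: misfit_def norm_sq_def case_prod_unfold)

lemma norm_sq_eq_0D:
  assumes "norm_sq nx ny nt I f = 0" "finite I" "nx > 0" "ny > 0" "nt > 0"
  shows "\<forall>(i, j, k)\<in>I. f i j k = 0"
proof -
  have "(\<Sum>(i, j, k)\<in>I. (f i j k)\<^sup>2) = 0"
    using assms by (simp add: norm_sq_def step_def)
  then show ?thesis
    using assms(2) unfolding case_prod_unfold by (subst (asm) sum_nonneg_eq_0_iff) auto
qed

lemma misfit_eq_0D: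
  assumes "misfit nx ny nt (r', mx', my') (r, mx, my) = 0" "nx > 0" "ny > 0" "nt > 0"
  shows "\<forall>(i, j, k)\<in>rho_ix nx ny nt. r i j k = r' i j k"
    and "\<forall>(i, j, k)\<in>mx_ix nx ny nt. mx i j k = mx' i j k"
    and "\<forall>(i, j, k)\<in>my_ix nx ny nt. my i j k = my' i j k"
proof -
  have "norm_sq nx ny nt (rho_ix nx ny nt) (\<lambda>i j k. r i j k - r' i j k) = 0"
    "norm_sq nx ny nt (mx_ix nx ny nt) (\<lambda>i j k. mx i j k - mx' i j k) = 0"
    "norm_sq nx ny nt (my_ix nx ny nt) (\<lambda>i j k. my i j k - my' i j k) = 0"
    using assms(1) norm_sq_nonneg[of nx ny nt "rho_ix nx ny nt" "\<lambda>i j k. r i j k - r' i j k"]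
      norm_sq_nonneg[of nx ny nt "mx_ix nx ny nt" "\<lambda>i j k. mx i j k - mx' i j k"]
      norm_sq_nonneg[of nx ny nt "my_ix nx ny nt" "\<lambda>i j k. my i j k - my' i j k"]
    unfolding misfit_def prod.case by linarith+
  from this(1)[THEN norm_sq_eq_0D] this(2)[THEN norm_sq_eq_0D] this(3)[THEN norm_sq_eq_0D]
  show "\<forall>(i, j, k)\<in>rho_ix nx ny nt. r i j k = r' i j k"
    and "\<forall>(i, j, k)\<in>mx_ix nx ny nt. mx i j k = mx' i j k"
    and "\<forall>(i, j, k)\<in>my_ix nx ny nt. my i j k = my' i j k"
    using assms(2-4) by (simp_all add: finite_ix)
qed

section \<open>Mass conservation and obstacles shifted by a constant\<close>

text \<open>Summed over space, the flux differences telescope to boundary fluxes, which vanish;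
  hence total mass does not change from one layer to the next.\<close>

lemma mass_conserved:
  assumes "(r, mx, my) \<in> constraint_set nx ny nt mu0" "k \<le> nt" "nt > 0"
  shows "(\<Sum>i=1..nx. \<Sum>j=1..ny. rho_ext mu0 r i j k) = (\<Sum>i=1..nx. \<Sum>j=1..ny. mu0 i j)"
  using assms(2)
proof (induction k)
  case 0
  then show ?case by (simp add: rho_ext_def)
next
  case (Suc k)
  let ?R = "rho_ext mu0 r" and ?X = "mx_ext nx mx" and ?Y = "my_ext ny my"
  have tele: "(\<Sum>i=1..n. g i - g (i - 1)) = g n - g 0" for n and g :: "nat \<Rightarrow> real"
    by (induction n) auto
  have "(?R i j (Suc k) - ?R i j k) / step nt
      = - ((?X i j (Suc k) - ?X (i - 1) j (Suc k)) / step nx)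
        - (?Y i j (Suc k) - ?Y i (j - 1) (Suc k)) / step ny"
    if "i \<in> {1..nx}" "j \<in> {1..ny}" for i j
  proof -
    have "(i, j, Suc k) \<in> rho_ix nx ny nt"
      using that Suc.prems by (auto simp: rho_ix_def)
    then show ?thesis using assms(1) by (fastforce simp: constraint_set_def)
  qed
  then have "(\<Sum>i=1..nx. \<Sum>j=1..ny. (?R i j (Suc k) - ?R i j k) / step nt)
      = (\<Sum>i=1..nx. \<Sum>j=1..ny. - ((?X i j (Suc k) - ?X (i - 1) j (Suc k)) / step nx)
          - (?Y i j (Suc k) - ?Y i (j - 1) (Suc k)) / step ny)"
    by (intro sum.cong refl)
  also have "\<dots> = - ((\<Sum>i=1..nx. \<Sum>j=1..ny. ?X i j (Suc k) - ?X (i - 1) j (Suc k)) / step nx)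
        - (\<Sum>i=1..nx. \<Sum>j=1..ny. ?Y i j (Suc k) - ?Y i (j - 1) (Suc k)) / step ny"
    by (simp only: sum_subtractf sum_negf sum_divide_distrib diff_divide_distrib)
  also have "(\<Sum>i=1..nx. \<Sum>j=1..ny. ?X i j (Suc k) - ?X (i - 1) j (Suc k)) = 0"
    \<comment> \<open>The swap makes \<open>i\<close>, the telescoping index, the inner one.\<close>
    by (subst sum.swap) (simp only: tele[of "\<lambda>i. ?X i _ _"], simp add: mx_ext_def)
  also have "(\<Sum>i=1..nx. \<Sum>j=1..ny. ?Y i j (Suc k) - ?Y i (j - 1) (Suc k)) = 0"
    by (simp only: tele[of "\<lambda>j. ?Y _ j _"], simp add: my_ext_def)
  finally have "((\<Sum>i=1..nx. \<Sum>j=1..ny. ?R i j (Suc k))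
      - (\<Sum>i=1..nx. \<Sum>j=1..ny. ?R i j k)) / step nt = 0"
    by (simp add: sum_subtractf sum_divide_distrib diff_divide_distrib)
  then show ?case using Suc assms(3) by (simp add: step_def)
qed

lemma nash_equilibrium_add_constant:
  assumes N: "nash_equilibrium nx ny nt gI gT mu0 mu1 bt s" and "nt > 0"
    and b: "\<forall>i\<in>{1..nx}. \<forall>j\<in>{1..ny}. b i j = bt i j + c"
  shows "nash_equilibrium nx ny nt gI gT mu0 mu1 b s"
proof -
  \<comment> \<open>Each of the \<open>nt\<close> layers carries the initial mass, so
    \<open>K\<close> is the same for all admissible states and does not affect which of them
    minimize.\<close>
  define K where "K = step nx * step ny * step nt * (c * (real nt * (\<Sum>i=1..nx. \<Sum>j=1..ny. mu0 i j)))"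
  have shift: "objective nx ny nt gI gT mu0 mu1 b (r, mx, my)
      = objective nx ny nt gI gT mu0 mu1 bt (r, mx, my) + K"
    if "(r, mx, my) \<in> constraint_set nx ny nt mu0" for r mx my
  proof -
    have "(\<Sum>(i, j, k) \<in> rho_ix nx ny nt. r i j k * (b i j - bt i j))
        = (\<Sum>i=1..nx. \<Sum>j=1..ny. \<Sum>k=1..nt. rho_ext mu0 r i j k * c)"
      unfolding sum_rho_ix using b by (intro sum.cong refl) (auto simp: rho_ext_def)
    \<comment> \<open>Time is moved outermost in two swaps, so that mass conservation applies to
      each layer.\<close>
    also have "\<dots> = (\<Sum>i=1..nx. \<Sum>k=1..nt. \<Sum>j=1..ny. rho_ext mu0 r i j k * c)"
      by (intro sum.cong refl sum.swap)
    also have "\<dots> = (\<Sum>k=1..nt. \<Sum>i=1..nx. \<Sum>j=1..ny. rho_ext mu0 r i j k * c)"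
      by (rule sum.swap)
    also have "\<dots> = (\<Sum>k=1..nt. (\<Sum>i=1..nx. \<Sum>j=1..ny. mu0 i j) * c)"
      using mass_conserved[OF that _ \<open>nt > 0\<close>]
      by (intro sum.cong refl) (simp flip: sum_distrib_right)
    finally show ?thesis
      unfolding objective_change_obstacle[of nx ny nt gI gT mu0 mu1 b r mx my bt] K_def
      by (simp add: mult_ac)
  qed
  show ?thesis
    using N unfolding nash_equilibrium_def is_arg_min_def by (auto simp: shift)
qed

theorem theorem3p9:
  fixes nx ny nt :: nat
    and gI gT :: real
    and mu0 mu1 bt :: array2
    and rt mxt myt :: array3
  assumes "nx \<ge> 2" and "ny \<ge> 2" and "nt \<ge> 1"
    and "gI \<ge> 0" and "gT \<ge> 0"
    and "\<forall>i\<in>{1..nx}. \<forall>j\<in>{1..ny}. mu0 i j \<ge> 0"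
    and "\<forall>i\<in>{1..nx}. \<forall>j\<in>{1..ny}. mu1 i j > 0"
    and "nash_equilibrium nx ny nt gI gT mu0 mu1 bt (rt, mxt, myt)"
    and "rho_positive nx ny nt rt"
  shows "\<forall>b. bilevel_minimizer nx ny nt gI gT mu0 mu1 (rt, mxt, myt) b \<longleftrightarrow>
               (\<exists>c. \<forall>i\<in>{1..nx}. \<forall>j\<in>{1..ny}. b i j = bt i j + c)"
proof (intro allI iffI)
  fix b
  have pos: "nx > 0" "ny > 0" "nt > 0" using assms(1-3) by auto
  {
    assume "bilevel_minimizer nx ny nt gI gT mu0 mu1 (rt, mxt, myt) b"
    then obtain r mx my where N: "nash_equilibrium nx ny nt gI gT mu0 mu1 b (r, mx, my)"
      and min: "\<And>b' s'. nash_equilibrium nx ny nt gI gT mu0 mu1 b' s' \<Longrightarrow>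
        misfit nx ny nt (rt, mxt, myt) (r, mx, my) \<le> misfit nx ny nt (rt, mxt, myt) s'"
      by (force simp: bilevel_minimizer_def is_arg_min_def not_less)
    \<comment> \<open>The target with its own obstacle \<open>bt\<close> is a competitor of misfit
      zero.\<close>
    have "misfit nx ny nt (rt, mxt, myt) (r, mx, my) = 0"
      using min[OF assms(8)] misfit_nonneg[of nx ny nt "(rt, mxt, myt)" "(r, mx, my)"]
      by (simp add: misfit_self)
    note objective_cong[OF misfit_eq_0D[OF this pos] assms(3)]
    \<comment> \<open>The target is admissible and has the same objective for \<open>b\<close> as
      the minimizer \<open>(r, mx, my)\<close>, so it is itself optimal for \<open>b\<close>. Now
      one state is optimal for both obstacles.\<close>
    then have "nash_equilibrium nx ny nt gI gT mu0 mu1 b (rt, mxt, myt)"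
      using N assms(8) by (simp add: nash_equilibrium_def is_arg_min_def)
    then show "\<exists>c. \<forall>i\<in>{1..nx}. \<forall>j\<in>{1..ny}. b i j = bt i j + c"
      by (rule obstacle_difference_constant[OF assms(8) _ assms(6) pos])
  next
    assume "\<exists>c. \<forall>i\<in>{1..nx}. \<forall>j\<in>{1..ny}. b i j = bt i j + c"
    then have "nash_equilibrium nx ny nt gI gT mu0 mu1 b (rt, mxt, myt)"
      using nash_equilibrium_add_constant[OF assms(8) pos(3)] by blast
    then show "bilevel_minimizer nx ny nt gI gT mu0 mu1 (rt, mxt, myt) b"
      unfolding bilevel_minimizer_def is_arg_min_def
      \<comment> \<open>The target serves as the lower-level minimizer for \<open>b\<close>; its
        misfit zero is the least possible value.\<close>
      by (intro exI[of _ "(rt, mxt, myt)"]) (auto simp: misfit_self not_less misfit_nonneg)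
  }
qed

end
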